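(* Let $(X,\tau)$ be a topological space and let $\varphi_1,\varphi_2\in O(X,\tau)$. Define $\mathrm{cl}^*:P(X)\to P(X)$ by $$\mathrm{cl}^*A=\{x\in X : \text{there exists a filter } \mathcal{F} \text{ on } X \text{ containing } A \text{ and } \varphi_{1,2}\text{-converging to } x\}\qquad (A\subset X).$$ (1) If $\varphi_2$ is regular with respect to $\varphi_1O(X)$, then $\mathrm{cl}^*A=\varphi_{1,2}\mathrm{cl}\,A$ for every $A\subset X$, and the operator $\mathrm{cl}^*$ defines the topology $$\tau^*=\{U\subset X:\mathrm{cl}^*(X\setminus U)\subset X\setminus U\}=\{U\subset X:\varphi_{1,2}\mathrm{cl}(X\setminus U)\subset X\setminus U\}=\tau_{\varphi_{1,2}}.$$ (2) If $\varphi_2$ is regular with respect to $\varphi_1O(X)$ and $\varphi_1O(X)\subset\varphi_2O(X)$, then the operator $\mathrm{cl}^*$ defines the topology $$\tau^*=\{U\subset X:\mathrm{cl}^*(X\setminus U)=X\setminus U\}=\{U\subset X:\varphi_{1,2}\mathrm{cl}(X\setminus U)=X\setminus U\}=\tau_{\varphi_{1,2}}.$$ (3) If $\varphi_2$ is regular with respect to $\varphi_1O(X)$, $\varphi_1O(X)\subset\varphi_2O(X)$, and $\varphi_2(U)\in\varphi_{1,2}O(X)$ for each $U\in\varphi_1O(X)$, then $\mathrm{cl}^*$ is a Kuratowski closure operator and again $\tau^*=\tau_{\varphi_{1,2}}$.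
   Context: Let $(X,\tau)$ be a topological space and let $A^{o}$ denote the interior of $A\subset X$. An operation on $(X,\tau)$ is a map $\varphi:P(X)\to P(X)$ with $A^{o}\subset\varphi(A)$ for all $A\in P(X)$ and $\varphi(\emptyset)=\emptyset$; $O(X,\tau)$ is the set of all operations. A set $A\subset X$ is $\varphi$-open if $A\subset\varphi(A)$; $\varphi O(X)$ is the family of all $\varphi$-open sets, and $\varphi O(X,x)=\{U\in\varphi O(X): x\in U\}$. An operation $\varphi$ is regular with respect to a family $\mathcal{U}\subset P(X)$ if for every $x\in X$ and all $U,V\in\mathcal{U}$ containing $x$ there is $W\in\mathcal{U}$ containing $x$ with $\varphi(W)\subset\varphi(U)\cap\varphi(V)$. For $A\subset X$: $x\in\varphi_{1,2}\mathrm{int}\,A$ iff there is $U\in\varphi_1O(X,x)$ with $\varphi_2(U)\subset A$; $x\in\varphi_{1,2}\mathrm{cl}\,A$ iff $\varphi_2(U)\cap A\neq\emptyset$ for every $U\in\varphi_1O(X,x)$. $A$ is $\varphi_{1,2}$-open if $A\subset\varphi_{1,2}\mathrm{int}\,A$; $\varphi_{1,2}O(X)$ is the family of $\varphi_{1,2}$-open sets. When $\varphi_2$ is regular with respect to $\varphi_1O(X)$, $\tau_{\varphi_{1,2}}$ denotes the family $\varphi_{1,2}O(X)$ (a topology on $X$). Filters are proper (do not contain $\emptyset$). A filter $\mathcal{F}$ $\varphi_{1,2}$-converges to $a\in X$ if for each $U\in\varphi_1O(X,a)$ there is $F\in\mathcal{F}$ with $F\subset\varphi_2(U)$. *)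

theory Defs
  imports "HOL-Analysis.Abstract_Topology"
begin

text \<open>
  The space is an abstract topology \<open>X\<close> with underlying set \<open>topspace X\<close> (possibly empty).
  A map \<open>P(X) \<rightarrow> P(X)\<close> is a function on \<open>'a set\<close> of which only the values at subsets of
  \<open>topspace X\<close> matter, and every family below consists of subsets of \<open>topspace X\<close>.
\<close>

definition operations :: "'a topology \<Rightarrow> ('a set \<Rightarrow> 'a set) set" where
  "operations X =
     {\<phi>. (\<forall>A. A \<subseteq> topspace X \<longrightarrow> \<phi> A \<subseteq> topspace X \<and> X interior_of A \<subseteq> \<phi> A) \<and> \<phi> {} = {}}"

definition phi_opens :: "'a topology \<Rightarrow> ('a set \<Rightarrow> 'a set) \<Rightarrow> 'a set set" where
  "phi_opens X \<phi> = {A. A \<subseteq> topspace X \<and> A \<subseteq> \<phi> A}"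

definition phi_opens_at :: "'a topology \<Rightarrow> ('a set \<Rightarrow> 'a set) \<Rightarrow> 'a \<Rightarrow> 'a set set" where
  "phi_opens_at X \<phi> x = {U \<in> phi_opens X \<phi>. x \<in> U}"

definition regular_wrt :: "'a topology \<Rightarrow> ('a set \<Rightarrow> 'a set) \<Rightarrow> 'a set set \<Rightarrow> bool" where
  "regular_wrt X \<phi> \<U> \<longleftrightarrow>
     (\<forall>x \<in> topspace X. \<forall>U \<in> \<U>. \<forall>V \<in> \<U>. x \<in> U \<and> x \<in> V \<longrightarrow>
        (\<exists>W \<in> \<U>. x \<in> W \<and> \<phi> W \<subseteq> \<phi> U \<inter> \<phi> V))"

definition phi12_int ::
  "'a topology \<Rightarrow> ('a set \<Rightarrow> 'a set) \<Rightarrow> ('a set \<Rightarrow> 'a set) \<Rightarrow> 'a set \<Rightarrow> 'a set" where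
  "phi12_int X \<phi>1 \<phi>2 A = {x \<in> topspace X. \<exists>U \<in> phi_opens_at X \<phi>1 x. \<phi>2 U \<subseteq> A}"

definition phi12_cl ::
  "'a topology \<Rightarrow> ('a set \<Rightarrow> 'a set) \<Rightarrow> ('a set \<Rightarrow> 'a set) \<Rightarrow> 'a set \<Rightarrow> 'a set" where
  "phi12_cl X \<phi>1 \<phi>2 A = {x \<in> topspace X. \<forall>U \<in> phi_opens_at X \<phi>1 x. \<phi>2 U \<inter> A \<noteq> {}}"

definition phi12_opens ::
  "'a topology \<Rightarrow> ('a set \<Rightarrow> 'a set) \<Rightarrow> ('a set \<Rightarrow> 'a set) \<Rightarrow> 'a set set" where
  "phi12_opens X \<phi>1 \<phi>2 = {A. A \<subseteq> topspace X \<and> A \<subseteq> phi12_int X \<phi>1 \<phi>2 A}"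

text \<open>
  A filter on \<open>X\<close> is a library filter, other than \<open>bot\<close>, that has \<open>topspace X\<close> as a member.
  Restricting its members to subsets of \<open>topspace X\<close> gives exactly the proper filters on the
  set \<open>topspace X\<close>; membership of a set \<open>S\<close> reads \<open>eventually (\<lambda>y. y \<in> S) F\<close>.
\<close>

definition proper_filter_on :: "'a set \<Rightarrow> 'a filter \<Rightarrow> bool" where
  "proper_filter_on S F \<longleftrightarrow> F \<noteq> bot \<and> eventually (\<lambda>y. y \<in> S) F"

definition phi12_converges ::
  "'a topology \<Rightarrow> ('a set \<Rightarrow> 'a set) \<Rightarrow> ('a set \<Rightarrow> 'a set) \<Rightarrow> 'a filter \<Rightarrow> 'a \<Rightarrow> bool" where
  "phi12_converges X \<phi>1 \<phi>2 F a \<longleftrightarrow>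
     (\<forall>U \<in> phi_opens_at X \<phi>1 a. \<exists>S. eventually (\<lambda>y. y \<in> S) F \<and> S \<subseteq> \<phi>2 U)"

definition cl_star ::
  "'a topology \<Rightarrow> ('a set \<Rightarrow> 'a set) \<Rightarrow> ('a set \<Rightarrow> 'a set) \<Rightarrow> 'a set \<Rightarrow> 'a set" where
  "cl_star X \<phi>1 \<phi>2 A =
     {x \<in> topspace X. \<exists>F. proper_filter_on (topspace X) F \<and>
        eventually (\<lambda>y. y \<in> A) F \<and> phi12_converges X \<phi>1 \<phi>2 F x}"

definition tau_star ::
  "'a topology \<Rightarrow> ('a set \<Rightarrow> 'a set) \<Rightarrow> ('a set \<Rightarrow> 'a set) \<Rightarrow> 'a set set" where
  "tau_star X \<phi>1 \<phi>2 =
     {U. U \<subseteq> topspace X \<and> cl_star X \<phi>1 \<phi>2 (topspace X - U) \<subseteq> topspace X - U}"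

text \<open>
  The predicate \<open>istopology\<close> does not fix the underlying set, hence the first two conjuncts.
\<close>

definition is_topology_on :: "'a set \<Rightarrow> 'a set set \<Rightarrow> bool" where
  "is_topology_on S T \<longleftrightarrow> T \<subseteq> Pow S \<and> S \<in> T \<and> istopology (\<lambda>U. U \<in> T)"

definition kuratowski_closure_on :: "'a set \<Rightarrow> ('a set \<Rightarrow> 'a set) \<Rightarrow> bool" where
  "kuratowski_closure_on S c \<longleftrightarrow>
     c {} = {} \<and>
     (\<forall>A. A \<subseteq> S \<longrightarrow> c A \<subseteq> S \<and> A \<subseteq> c A \<and> c (c A) = c A) \<and>
     (\<forall>A B. A \<subseteq> S \<and> B \<subseteq> S \<longrightarrow> c (A \<union> B) = c A \<union> c B)"

end

theory Submission
  imports Defs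
begin

text \<open>
  If \<open>x\<close> lies in the \<open>\<phi>\<^sub>1\<^sub>,\<^sub>2\<close>-closure of \<open>A\<close>, then by regularity the sets \<open>\<phi>\<^sub>2(U) \<inter> A\<close>, for
  \<open>U\<close> a \<open>\<phi>\<^sub>1\<close>-open set around \<open>x\<close>, form a base of a proper filter, which contains \<open>A\<close> and
  converges to \<open>x\<close>. Hence the filter closure is the \<open>\<phi>\<^sub>1\<^sub>,\<^sub>2\<close>-closure, which is dual to the
  \<open>\<phi>\<^sub>1\<^sub>,\<^sub>2\<close>-interior under complementation.
\<close>

section \<open>Elementary properties of the closure \<open>phi12_cl\<close>\<close>

lemma topspace_in_phi_opens:
  assumes "\<phi> \<in> operations X"
  shows "topspace X \<in> phi_opens X \<phi>"
proof -
  have "X interior_of topspace X \<subseteq> \<phi> (topspace X)"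
    using assms unfolding operations_def by blast
  then show ?thesis
    unfolding phi_opens_def by simp
qed

lemma operation_subset_topspace:
  assumes "\<phi>2 \<in> operations X" and "U \<in> phi_opens X \<phi>1"
  shows "\<phi>2 U \<subseteq> topspace X"
  using assms unfolding operations_def phi_opens_def by blast

text \<open>The whole space is \<phi>1-open, so each point has at least one set \<open>U\<close> to
  test, and \<open>\<phi>2 U\<close> cannot meet the empty set.\<close>

lemma phi12_cl_empty:
  assumes "\<phi>1 \<in> operations X"
  shows "phi12_cl X \<phi>1 \<phi>2 {} = {}"
  using topspace_in_phi_opens[OF assms] unfolding phi12_cl_def phi_opens_at_def by auto

lemma phi12_cl_subset_topspace: "phi12_cl X \<phi>1 \<phi>2 A \<subseteq> topspace X"
  unfolding phi12_cl_def by blast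

lemma phi12_cl_mono:
  assumes "A \<subseteq> B"
  shows "phi12_cl X \<phi>1 \<phi>2 A \<subseteq> phi12_cl X \<phi>1 \<phi>2 B"
  using assms unfolding phi12_cl_def by blast

lemma regular_wrtD:
  assumes "regular_wrt X \<phi>2 (phi_opens X \<phi>1)"
    and "U \<in> phi_opens_at X \<phi>1 x" and "V \<in> phi_opens_at X \<phi>1 x"
  obtains W where "W \<in> phi_opens_at X \<phi>1 x" and "\<phi>2 W \<subseteq> \<phi>2 U \<inter> \<phi>2 V"
proof -
  have "x \<in> topspace X"
    using assms(2) unfolding phi_opens_at_def phi_opens_def by blast
  then show thesis
    using assms that unfolding regular_wrt_def phi_opens_at_def by blast
qed

text \<open>For a point outside both closures, some \<open>\<phi>2 U\<close> misses \<open>A\<close>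
  and some \<open>\<phi>2 V\<close> misses \<open>B\<close>. Regularity replaces the two by a single
  \<open>\<phi>2 W\<close>, which misses the union; the converse is monotonicity.\<close>

lemma phi12_cl_Un:
  assumes "regular_wrt X \<phi>2 (phi_opens X \<phi>1)"
  shows "phi12_cl X \<phi>1 \<phi>2 (A \<union> B) = phi12_cl X \<phi>1 \<phi>2 A \<union> phi12_cl X \<phi>1 \<phi>2 B"
proof
  show "phi12_cl X \<phi>1 \<phi>2 (A \<union> B) \<subseteq> phi12_cl X \<phi>1 \<phi>2 A \<union> phi12_cl X \<phi>1 \<phi>2 B"
  proof (rule subsetI, rule ccontr)
    fix x
    assume x: "x \<in> phi12_cl X \<phi>1 \<phi>2 (A \<union> B)"
      and nx: "x \<notin> phi12_cl X \<phi>1 \<phi>2 A \<union> phi12_cl X \<phi>1 \<phi>2 B"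
    obtain U V where UV: "U \<in> phi_opens_at X \<phi>1 x" "V \<in> phi_opens_at X \<phi>1 x"
      and disj: "\<phi>2 U \<inter> A = {}" "\<phi>2 V \<inter> B = {}"
      using x nx unfolding phi12_cl_def by blast
    obtain W where "W \<in> phi_opens_at X \<phi>1 x" "\<phi>2 W \<subseteq> \<phi>2 U \<inter> \<phi>2 V"
      using regular_wrtD[OF assms UV] .
    with x disj show False
      unfolding phi12_cl_def by blast
  qed
next
  show "phi12_cl X \<phi>1 \<phi>2 A \<union> phi12_cl X \<phi>1 \<phi>2 B \<subseteq> phi12_cl X \<phi>1 \<phi>2 (A \<union> B)"
    by (simp add: phi12_cl_mono)
qed

text \<open>A \<phi>1-open \<open>U\<close> around \<open>x\<close> is also \<phi>2-open, hence
  \<open>x\<close> itself lies in \<open>\<phi>2 U\<close> and witnesses that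
  \<open>\<phi>2 U\<close> meets \<open>A\<close>.\<close>

lemma phi12_cl_extensive:
  assumes "phi_opens X \<phi>1 \<subseteq> phi_opens X \<phi>2" and "A \<subseteq> topspace X"
  shows "A \<subseteq> phi12_cl X \<phi>1 \<phi>2 A"
proof
  fix x
  assume "x \<in> A"
  moreover have "x \<in> \<phi>2 U" if "U \<in> phi_opens_at X \<phi>1 x" for U
    using that assms(1) unfolding phi_opens_at_def phi_opens_def by blast
  ultimately show "x \<in> phi12_cl X \<phi>1 \<phi>2 A"
    using assms(2) unfolding phi12_cl_def by blast
qed

text \<open>This is the nontrivial half of idempotence. The set \<open>\<phi>2 U\<close> meets the
  closure of \<open>A\<close> at some \<open>y\<close>; being \<phi>12-open, it contains
  \<open>\<phi>2 V\<close> for some \<phi>1-open \<open>V\<close> around \<open>y\<close>, and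
  \<open>\<phi>2 V\<close> meets \<open>A\<close>.\<close>

lemma phi12_cl_phi12_cl_subset:
  assumes "\<forall>U \<in> phi_opens X \<phi>1. \<phi>2 U \<in> phi12_opens X \<phi>1 \<phi>2"
  shows "phi12_cl X \<phi>1 \<phi>2 (phi12_cl X \<phi>1 \<phi>2 A) \<subseteq> phi12_cl X \<phi>1 \<phi>2 A"
proof
  fix x
  assume x: "x \<in> phi12_cl X \<phi>1 \<phi>2 (phi12_cl X \<phi>1 \<phi>2 A)"
  have "\<phi>2 U \<inter> A \<noteq> {}" if U: "U \<in> phi_opens_at X \<phi>1 x" for U
  proof -
    obtain y where y: "y \<in> \<phi>2 U" "y \<in> phi12_cl X \<phi>1 \<phi>2 A"
      using x U unfolding phi12_cl_def by blast
    have "y \<in> phi12_int X \<phi>1 \<phi>2 (\<phi>2 U)"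
      using y(1) U assms unfolding phi_opens_at_def phi12_opens_def by blast
    then obtain V where "V \<in> phi_opens_at X \<phi>1 y" "\<phi>2 V \<subseteq> \<phi>2 U"
      unfolding phi12_int_def by blast
    with y(2) show ?thesis
      unfolding phi12_cl_def by blast
  qed
  with x show "x \<in> phi12_cl X \<phi>1 \<phi>2 A"
    unfolding phi12_cl_def by blast
qed

section \<open>Duality of closure and interior, and the topology of \<phi>12-open sets\<close>

lemma phi12_cl_complement:
  assumes "\<phi>2 \<in> operations X"
  shows "phi12_cl X \<phi>1 \<phi>2 (topspace X - U) = topspace X - phi12_int X \<phi>1 \<phi>2 U"
proof -
  \<comment> \<open>Since \<open>\<phi>2 V\<close> stays inside the space, missing the complement of
    \<open>U\<close> amounts to lying in \<open>U\<close>.\<close>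
  have "\<phi>2 V \<inter> (topspace X - U) = {} \<longleftrightarrow> \<phi>2 V \<subseteq> U" if "V \<in> phi_opens_at X \<phi>1 x" for V x
    using operation_subset_topspace[OF assms, of V \<phi>1] that unfolding phi_opens_at_def by blast
  then show ?thesis
    unfolding phi12_cl_def phi12_int_def by blast
qed

lemma phi12_opens_eq_closed_complement:
  assumes "\<phi>2 \<in> operations X"
  shows "phi12_opens X \<phi>1 \<phi>2 =
    {U. U \<subseteq> topspace X \<and> phi12_cl X \<phi>1 \<phi>2 (topspace X - U) \<subseteq> topspace X - U}"
  unfolding phi12_opens_def phi12_cl_complement[OF assms] by blast

text \<open>The whole space and binary intersections are treated through complements, where the
  closure of the empty set and additivity of the closure apply. Unions are treated through the
  interior: a set \<open>U\<close> witnessing \<open>x\<close> in the interior of \<open>S\<close>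
  also does so for any larger set.\<close>

lemma is_topology_on_phi12_opens:
  assumes "\<phi>1 \<in> operations X" and "\<phi>2 \<in> operations X"
    and "regular_wrt X \<phi>2 (phi_opens X \<phi>1)"
  shows "is_topology_on (topspace X) (phi12_opens X \<phi>1 \<phi>2)"
proof -
  have "topspace X \<in> phi12_opens X \<phi>1 \<phi>2"
    unfolding phi12_opens_eq_closed_complement[OF assms(2)]
    by (simp add: phi12_cl_empty[OF assms(1)])
  moreover have "S \<inter> T \<in> phi12_opens X \<phi>1 \<phi>2"
    if "S \<in> phi12_opens X \<phi>1 \<phi>2" "T \<in> phi12_opens X \<phi>1 \<phi>2" for S T
  proof -
    have "phi12_cl X \<phi>1 \<phi>2 (topspace X - S \<inter> T) \<subseteq> topspace X - S \<inter> T"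
      using that unfolding phi12_opens_eq_closed_complement[OF assms(2)] Diff_Int phi12_cl_Un[OF assms(3)]
      by blast
    with that show ?thesis
      unfolding phi12_opens_eq_closed_complement[OF assms(2)] by blast
  qed
  moreover have "\<Union>\<K> \<in> phi12_opens X \<phi>1 \<phi>2" if \<K>: "\<forall>S\<in>\<K>. S \<in> phi12_opens X \<phi>1 \<phi>2" for \<K>
  proof -
    have "x \<in> phi12_int X \<phi>1 \<phi>2 (\<Union>\<K>)" if "S \<in> \<K>" "x \<in> S" for S x
    proof -
      have "x \<in> phi12_int X \<phi>1 \<phi>2 S"
        using \<K> that unfolding phi12_opens_def by blast
      then show ?thesis
        using \<open>S \<in> \<K>\<close> unfolding phi12_int_def by blast
    qed
    with \<K> show ?thesis
      unfolding phi12_opens_def by blast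
  qed
  moreover have "phi12_opens X \<phi>1 \<phi>2 \<subseteq> Pow (topspace X)"
    unfolding phi12_opens_def by blast
  ultimately show ?thesis
    unfolding is_topology_on_def istopology_def by blast
qed

section \<open>Agreement of the filter closure with \<open>phi12_cl\<close>\<close>

lemma cl_star_subset_phi12_cl: "cl_star X \<phi>1 \<phi>2 A \<subseteq> phi12_cl X \<phi>1 \<phi>2 A"
proof
  fix x
  assume "x \<in> cl_star X \<phi>1 \<phi>2 A"
  then obtain F where x: "x \<in> topspace X" and F: "F \<noteq> bot" "eventually (\<lambda>y. y \<in> A) F"
    and conv: "phi12_converges X \<phi>1 \<phi>2 F x"
    unfolding cl_star_def proper_filter_on_def by blast
  have "\<phi>2 U \<inter> A \<noteq> {}" if U: "U \<in> phi_opens_at X \<phi>1 x" for U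
  proof -
    obtain S where S: "eventually (\<lambda>y. y \<in> S) F" "S \<subseteq> \<phi>2 U"
      using conv U unfolding phi12_converges_def by blast
    \<comment> \<open>Members of a proper filter are nonempty, so it suffices that this intersection
      is a member.\<close>
    have "eventually (\<lambda>y. y \<in> \<phi>2 U \<inter> A) F"
      using eventually_conj[OF S(1) F(2)] by (rule eventually_mono) (use S(2) in blast)
    from eventually_happens'[OF F(1) this] show ?thesis
      by blast
  qed
  with x show "x \<in> phi12_cl X \<phi>1 \<phi>2 A"
    unfolding phi12_cl_def by blast
qed

lemma phi12_cl_subset_cl_star:
  assumes "\<phi>1 \<in> operations X" and "regular_wrt X \<phi>2 (phi_opens X \<phi>1)" and "A \<subseteq> topspace X"
  shows "phi12_cl X \<phi>1 \<phi>2 A \<subseteq> cl_star X \<phi>1 \<phi>2 A"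
proof
  fix x
  assume x: "x \<in> phi12_cl X \<phi>1 \<phi>2 A"
  let ?B = "phi_opens_at X \<phi>1 x"
  define F where "F = (INF U\<in>?B. principal (\<phi>2 U \<inter> A))"
  \<comment> \<open>The whole space belongs to \<open>?B\<close>. Over an empty index family the
    infimum would be the filter \<open>top\<close>.\<close>
  have ne: "?B \<noteq> {}"
    using topspace_in_phi_opens[OF assms(1)] x unfolding phi_opens_at_def phi12_cl_def by blast
  \<comment> \<open>Regularity makes the generating sets downward directed, so they form a base: a
    property holds eventually exactly when it holds throughout one of them.\<close>
  have ev: "eventually P F \<longleftrightarrow> (\<exists>U\<in>?B. \<forall>y\<in>\<phi>2 U \<inter> A. P y)" for P
    unfolding F_def
  proof (subst eventually_INF_base[OF ne])
    fix U V
    assume UV: "U \<in> ?B" "V \<in> ?B"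
    obtain W where "W \<in> ?B" "\<phi>2 W \<subseteq> \<phi>2 U \<inter> \<phi>2 V"
      using regular_wrtD[OF assms(2) UV] .
    then show "\<exists>W\<in>?B. principal (\<phi>2 W \<inter> A) \<le> inf (principal (\<phi>2 U \<inter> A)) (principal (\<phi>2 V \<inter> A))"
      unfolding inf_principal principal_le_iff by blast
  qed (simp add: eventually_principal)
  \<comment> \<open>By \<open>ev\<close>, the filter is improper only if some
    \<open>\<phi>2 U \<inter> A\<close> is empty, which membership of \<open>x\<close> in the
    closure excludes.\<close>
  have "F \<noteq> bot"
    using x unfolding trivial_limit_def ev unfolding phi12_cl_def by blast
  moreover have A: "eventually (\<lambda>y. y \<in> A) F"
    using ne unfolding ev by blast
  moreover have "eventually (\<lambda>y. y \<in> topspace X) F"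
    using A by (rule eventually_mono) (use assms(3) in blast)
  moreover have "eventually (\<lambda>y. y \<in> \<phi>2 U) F" if "U \<in> ?B" for U
    using that unfolding ev by blast
  then have "phi12_converges X \<phi>1 \<phi>2 F x"
    unfolding phi12_converges_def by blast
  moreover have "x \<in> topspace X"
    using x phi12_cl_subset_topspace by (rule rev_subsetD)
  ultimately show "x \<in> cl_star X \<phi>1 \<phi>2 A"
    unfolding cl_star_def proper_filter_on_def by blast
qed

lemma cl_star_eq_phi12_cl:
  assumes "\<phi>1 \<in> operations X" and "regular_wrt X \<phi>2 (phi_opens X \<phi>1)" and "A \<subseteq> topspace X"
  shows "cl_star X \<phi>1 \<phi>2 A = phi12_cl X \<phi>1 \<phi>2 A"
  using cl_star_subset_phi12_cl phi12_cl_subset_cl_star[OF assms] by (rule subset_antisym)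

section \<open>The topology \<open>tau_star\<close> and the Kuratowski axioms\<close>

lemma tau_star_eq_phi12_opens:
  assumes "\<phi>1 \<in> operations X" and "\<phi>2 \<in> operations X"
    and "regular_wrt X \<phi>2 (phi_opens X \<phi>1)"
  shows "tau_star X \<phi>1 \<phi>2 = phi12_opens X \<phi>1 \<phi>2"
  unfolding tau_star_def phi12_opens_eq_closed_complement[OF assms(2)]
  by (simp add: cl_star_eq_phi12_cl[OF assms(1,3)])

text \<open>Extensivity supplies the reverse inclusion, turning the closedness condition on
  complements into an equality.\<close>

lemma phi12_opens_eq_closed_complement':
  assumes "\<phi>2 \<in> operations X" and "phi_opens X \<phi>1 \<subseteq> phi_opens X \<phi>2"
  shows "phi12_opens X \<phi>1 \<phi>2 =
    {U. U \<subseteq> topspace X \<and> phi12_cl X \<phi>1 \<phi>2 (topspace X - U) = topspace X - U}"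
  unfolding phi12_opens_eq_closed_complement[OF assms(1)]
  using phi12_cl_extensive[OF assms(2) Diff_subset] by blast

lemma tau_star_eq_closed_complement:
  assumes "\<phi>1 \<in> operations X" and "\<phi>2 \<in> operations X"
    and "regular_wrt X \<phi>2 (phi_opens X \<phi>1)" and "phi_opens X \<phi>1 \<subseteq> phi_opens X \<phi>2"
  shows "tau_star X \<phi>1 \<phi>2 =
    {U. U \<subseteq> topspace X \<and> cl_star X \<phi>1 \<phi>2 (topspace X - U) = topspace X - U}"
  unfolding cl_star_eq_phi12_cl[OF assms(1,3) Diff_subset] tau_star_eq_phi12_opens[OF assms(1-3)]
  by (rule phi12_opens_eq_closed_complement'[OF assms(2,4)])

text \<open>The axioms are checked for \<open>phi12_cl\<close>: regularity gives additivity, the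
  inclusion of open families gives extensivity, and \<phi>12-openness of the sets
  \<open>\<phi>2 U\<close> gives idempotence.\<close>

lemma kuratowski_closure_on_cl_star:
  assumes "\<phi>1 \<in> operations X" and "regular_wrt X \<phi>2 (phi_opens X \<phi>1)"
    and "phi_opens X \<phi>1 \<subseteq> phi_opens X \<phi>2"
    and "\<forall>U \<in> phi_opens X \<phi>1. \<phi>2 U \<in> phi12_opens X \<phi>1 \<phi>2"
  shows "kuratowski_closure_on (topspace X) (cl_star X \<phi>1 \<phi>2)"
proof -
  \<comment> \<open>The first rule rewrites only at subsets of the space; the second discharges that
    condition for the outer closure in \<open>c (c A)\<close>.\<close>
  note [simp] = cl_star_eq_phi12_cl[OF assms(1,2)] phi12_cl_subset_topspace
  have "phi12_cl X \<phi>1 \<phi>2 (phi12_cl X \<phi>1 \<phi>2 A) = phi12_cl X \<phi>1 \<phi>2 A" for A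
    using phi12_cl_phi12_cl_subset[OF assms(4)]
      phi12_cl_extensive[OF assms(3) phi12_cl_subset_topspace] by (rule subset_antisym)
  then show ?thesis
    unfolding kuratowski_closure_on_def
    by (simp add: phi12_cl_empty[OF assms(1)] phi12_cl_extensive[OF assms(3)]
        phi12_cl_Un[OF assms(2)])
qed

theorem theorem2p10:
  fixes X :: "'a topology" and \<phi>1 \<phi>2 :: "'a set \<Rightarrow> 'a set"
  assumes "\<phi>1 \<in> operations X" and "\<phi>2 \<in> operations X"
  shows
    "(regular_wrt X \<phi>2 (phi_opens X \<phi>1) \<longrightarrow>
        (\<forall>A. A \<subseteq> topspace X \<longrightarrow> cl_star X \<phi>1 \<phi>2 A = phi12_cl X \<phi>1 \<phi>2 A) \<and>
        is_topology_on (topspace X) (tau_star X \<phi>1 \<phi>2) \<and>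
        tau_star X \<phi>1 \<phi>2 =
          {U. U \<subseteq> topspace X \<and> cl_star X \<phi>1 \<phi>2 (topspace X - U) \<subseteq> topspace X - U} \<and>
        tau_star X \<phi>1 \<phi>2 =
          {U. U \<subseteq> topspace X \<and> phi12_cl X \<phi>1 \<phi>2 (topspace X - U) \<subseteq> topspace X - U} \<and>
        tau_star X \<phi>1 \<phi>2 = phi12_opens X \<phi>1 \<phi>2)
     \<and>
     (regular_wrt X \<phi>2 (phi_opens X \<phi>1) \<and> phi_opens X \<phi>1 \<subseteq> phi_opens X \<phi>2 \<longrightarrow>
        is_topology_on (topspace X) (tau_star X \<phi>1 \<phi>2) \<and>
        tau_star X \<phi>1 \<phi>2 =
          {U. U \<subseteq> topspace X \<and> cl_star X \<phi>1 \<phi>2 (topspace X - U) = topspace X - U} \<and>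
        tau_star X \<phi>1 \<phi>2 =
          {U. U \<subseteq> topspace X \<and> phi12_cl X \<phi>1 \<phi>2 (topspace X - U) = topspace X - U} \<and>
        tau_star X \<phi>1 \<phi>2 = phi12_opens X \<phi>1 \<phi>2)
     \<and>
     (regular_wrt X \<phi>2 (phi_opens X \<phi>1) \<and> phi_opens X \<phi>1 \<subseteq> phi_opens X \<phi>2 \<and>
      (\<forall>U \<in> phi_opens X \<phi>1. \<phi>2 U \<in> phi12_opens X \<phi>1 \<phi>2) \<longrightarrow>
        kuratowski_closure_on (topspace X) (cl_star X \<phi>1 \<phi>2) \<and>
        tau_star X \<phi>1 \<phi>2 =
          {U. U \<subseteq> topspace X \<and> cl_star X \<phi>1 \<phi>2 (topspace X - U) = topspace X - U} \<and>
        tau_star X \<phi>1 \<phi>2 = phi12_opens X \<phi>1 \<phi>2)"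
\<comment> \<open>Cases 1 to 5 belong to the first claim, 6 to 9 to the second and 10 to 12 to the
  third.\<close>
proof (intro conjI impI, goal_cases)
  case 1
  then show ?case using cl_star_eq_phi12_cl[OF assms(1)] by blast
next
  case 2
  then show ?case
    using is_topology_on_phi12_opens[OF assms] unfolding tau_star_eq_phi12_opens[OF assms 2] by blast
next
  case 3
  show ?case by (rule tau_star_def)
next
  case 4
  show ?case
    unfolding tau_star_eq_phi12_opens[OF assms 4] by (rule phi12_opens_eq_closed_complement[OF assms(2)])
next
  case 5
  show ?case by (rule tau_star_eq_phi12_opens[OF assms 5])
next
  case 6
  then show ?case
    using is_topology_on_phi12_opens[OF assms] tau_star_eq_phi12_opens[OF assms] by metis
next
  case 7
  then show ?case
    using tau_star_eq_closed_complement[OF assms] by blast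
next
  case 8
  then show ?case
    using phi12_opens_eq_closed_complement'[OF assms(2)] tau_star_eq_phi12_opens[OF assms] by blast
next
  case 9
  then show ?case using tau_star_eq_phi12_opens[OF assms] by blast
next
  case 10
  then show ?case using kuratowski_closure_on_cl_star[OF assms(1)] by blast
next
  case 11
  then show ?case
    using tau_star_eq_closed_complement[OF assms] by blast
next
  case 12
  then show ?case using tau_star_eq_phi12_opens[OF assms] by blast
qed

end
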